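(* Let $\mu$ be a weight measure over the alphabet $\Sigma$ with respect to a strictly totally ordered monoid $A$. Then: 1. there exists $w\in\Sigma^*$ such that $|\mathcal{P}_\mu(w)| = 0$ if and only if $\mu$ is gapful; 2. there exists $w\in\Sigma^*$ such that $|\mathcal{P}_\mu(w)| > 1$ if and only if $\mu$ is not injective; 3. $|\mathcal{P}_\mu(w)| = 1$ holds for all $w\in\Sigma^*$ if and only if $\mu$ is gapfree and injective.
   Context: An alphabet $\Sigma$ is a finite set; $\Sigma^*$ is the free monoid of finite words over $\Sigma$, $\varepsilon$ the empty word, $\Sigma^+=\Sigma^*\setminus\{\varepsilon\}$, $|w|$ the length of $w$, $w[i]$ its $i$-th letter. $[n]=\{1,\dots,n\}$, $[n]_0=\{0,\dots,n\}$. $\mathrm{Fact}_i(w)$ is the set of factors (contiguous subwords) of $w$ of length $i$. A strictly totally ordered monoid is a monoid $(A,\circ_A)$ with neutral element $1_A$ and a total order $<_A$ such that $a<_A b$ implies $a\circ_A c<_A b\circ_A c$ and $c\circ_A a<_A c\circ_A b$ for all $a,b,c\in A$. A weight measure over $\Sigma$ w.r.t. $A$ is a monoid morphism $\mu:\Sigma^*\to A$ such that $\mu(vw)=\mu(wv)$ and $\mu(w)<_A\mu(wv)$ for all $w\in\Sigma^*$, $v\in\Sigma^+$. For $w\in\Sigma^*$ define $f_{w,\mu},p_{w,\mu}:[|w|]_0\to A$ by $f_{w,\mu}(i)=\max\{\mu(u)\mid u\in\mathrm{Fact}_i(w)\}$ and $p_{w,\mu}(i)=\mu(\text{prefix of }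 w \text{ of length } i)$. Words $w,w'$ are factor-weight equivalent, $w\sim_\mu w'$, if $f_{w,\mu}=f_{w',\mu}$ (as functions, in particular with equal domains); $[w]_{\sim_\mu}$ is the equivalence class of $w$. Put $\mathcal{P}_\mu(w)=\{v\in[w]_{\sim_\mu}\mid p_{v,\mu}=f_{v,\mu}\}$. $\mu$ is injective if it is injective on the set of letters $\Sigma$. $\mu$ is gapfree if for all $w\in\Sigma^*$ and all $i\in[|w|]$ there is $a\in\Sigma$ with $f_{w,\mu}(i)=f_{w,\mu}(i-1)\circ_A\mu(a)$; otherwise it is gapful. *)

theory Defs
  imports Main "HOL-Library.Sublist"
begin

class strict_total_ordered_monoid = monoid_mult + linorder +
  assumes mult_strict_right: "a < b \<Longrightarrow> a * c < b * c"
    and mult_strict_left: "a < b \<Longrightarrow> c * a < c * b"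

text \<open>An alphabet is a finite, possibly empty, set \<open>\<Sigma>\<close>; its words are the elements of
  \<open>lists \<Sigma>\<close>. The value of \<open>\<mu>\<close> on lists outside \<open>lists \<Sigma>\<close> is irrelevant.\<close>

definition weight_measure ::
    "'a set \<Rightarrow> ('a list \<Rightarrow> 'm::strict_total_ordered_monoid) \<Rightarrow> bool" where
  "weight_measure \<Sigma> \<mu> \<longleftrightarrow>
     \<mu> [] = 1 \<and>
     (\<forall>v\<in>lists \<Sigma>. \<forall>w\<in>lists \<Sigma>. \<mu> (v @ w) = \<mu> v * \<mu> w) \<and>
     (\<forall>w\<in>lists \<Sigma>. \<forall>v\<in>lists \<Sigma> - {[]}. \<mu> (v @ w) = \<mu> (w @ v) \<and> \<mu> w < \<mu> (w @ v))"

definition factors :: "nat \<Rightarrow> 'a list \<Rightarrow> 'a list set" where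
  "factors i w = {u. sublist u w \<and> length u = i}"

text \<open>The next two functions are only meaningful, and only used, for \<open>i \<le> length w\<close>.\<close>

definition factor_weight :: "('a list \<Rightarrow> 'm::linorder) \<Rightarrow> 'a list \<Rightarrow> nat \<Rightarrow> 'm" where
  "factor_weight \<mu> w i = Max (\<mu> ` factors i w)"

definition prefix_weight :: "('a list \<Rightarrow> 'm) \<Rightarrow> 'a list \<Rightarrow> nat \<Rightarrow> 'm" where
  "prefix_weight \<mu> w i = \<mu> (take i w)"

text \<open>Equality of functions with domain \<open>{0..length w}\<close> includes equality of the domains.\<close>

definition factor_weight_equiv ::
    "('a list \<Rightarrow> 'm::linorder) \<Rightarrow> 'a list \<Rightarrow> 'a list \<Rightarrow> bool" where
  "factor_weight_equiv \<mu> w w' \<longleftrightarrow>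
     length w = length w' \<and> (\<forall>i\<le>length w. factor_weight \<mu> w i = factor_weight \<mu> w' i)"

definition factor_weight_class ::
    "'a set \<Rightarrow> ('a list \<Rightarrow> 'm::linorder) \<Rightarrow> 'a list \<Rightarrow> 'a list set" where
  "factor_weight_class \<Sigma> \<mu> w = {v \<in> lists \<Sigma>. factor_weight_equiv \<mu> w v}"

definition prefix_normal_words ::
    "'a set \<Rightarrow> ('a list \<Rightarrow> 'm::linorder) \<Rightarrow> 'a list \<Rightarrow> 'a list set" where
  "prefix_normal_words \<Sigma> \<mu> w =
     {v \<in> factor_weight_class \<Sigma> \<mu> w. \<forall>i\<le>length v. prefix_weight \<mu> v i = factor_weight \<mu> v i}"

definition injective_measure :: "'a set \<Rightarrow> ('a list \<Rightarrow> 'm) \<Rightarrow> bool" where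
  "injective_measure \<Sigma> \<mu> \<longleftrightarrow> inj_on (\<lambda>a. \<mu> [a]) \<Sigma>"

definition gapfree ::
    "'a set \<Rightarrow> ('a list \<Rightarrow> 'm::strict_total_ordered_monoid) \<Rightarrow> bool" where
  "gapfree \<Sigma> \<mu> \<longleftrightarrow>
     (\<forall>w\<in>lists \<Sigma>. \<forall>i\<in>{1..length w}. \<exists>a\<in>\<Sigma>.
        factor_weight \<mu> w i = factor_weight \<mu> w (i - 1) * \<mu> [a])"

abbreviation gapful ::
    "'a set \<Rightarrow> ('a list \<Rightarrow> 'm::strict_total_ordered_monoid) \<Rightarrow> bool" where
  "gapful \<Sigma> \<mu> \<equiv> \<not> gapfree \<Sigma> \<mu>"

end

theory Submission
  imports Defs
begin

text \<open>Factor weights are subadditive: \<open>f\<^sub>w (i + j) \<le> f\<^sub>w i \<circ> f\<^sub>w j\<close>. Hence, if the prefix weights of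
  \<open>v\<close> are the factor weights of \<open>w\<close>, cancelling the weight of the prefix in front of a factor of
  \<open>v\<close> bounds that factor by \<open>f\<^sub>w\<close>, so \<open>v\<close> is equivalent to \<open>w\<close> and prefix normal. The prefix
  normal words of the class of \<open>w\<close> are therefore the words obtained by choosing, for each \<open>i\<close>, a
  letter that takes \<open>f\<^sub>w (i - 1)\<close> to \<open>f\<^sub>w i\<close>: gapfreeness gives at least one choice, and
  injectivity at most one.\<close>

text \<open>Since the order is total, strict monotonicity also reflects the order, which makes left
  cancellation available.\<close>

lemma mult_left_le_cancel_iff:
  fixes a b c :: "'m::strict_total_ordered_monoid"
  shows "c * a \<le> c * b \<longleftrightarrow> a \<le> b"
  using mult_strict_left[of a b c] mult_strict_left[of b a c] by (cases a b rule: linorder_cases) auto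

lemma mult_left_eq_cancel_iff:
  fixes a b c :: "'m::strict_total_ordered_monoid"
  shows "c * a = c * b \<longleftrightarrow> a = b"
  by (simp add: order_eq_iff mult_left_le_cancel_iff)

lemma mult_le_mono:
  fixes a b c d :: "'m::strict_total_ordered_monoid"
  assumes "a \<le> b" "c \<le> d"
  shows "a * c \<le> b * d"
proof -
  have "a * c \<le> b * c"
    using assms(1) mult_strict_right[of a b c] by (auto simp: le_less)
  also have "\<dots> \<le> b * d"
    using assms(2) by (simp add: mult_left_le_cancel_iff)
  finally show ?thesis .
qed

lemma finite_factors: "finite (factors i w)"
proof (rule finite_subset)
  show "factors i w \<subseteq> set (sublists w)"
    by (auto simp: factors_def)
qed simp

lemma factors_subset_lists: "w \<in> lists \<Sigma> \<Longrightarrow> factors i w \<subseteq> lists \<Sigma>"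
  by (auto simp: factors_def dest!: set_mono_sublist)

lemma take_in_factors: "i \<le> length w \<Longrightarrow> take i w \<in> factors i w"
  by (auto simp: factors_def intro: prefix_imp_sublist take_is_prefix)

lemma factor_weight_ge: "u \<in> factors i w \<Longrightarrow> \<mu> u \<le> factor_weight \<mu> w i"
  unfolding factor_weight_def by (intro Max_ge finite_imageI finite_factors imageI)

text \<open>The prefix of length \<open>i\<close> keeps the set under \<open>Max\<close> nonempty;
  for \<open>i\<close> beyond the length of \<open>w\<close> that set would be empty.\<close>

lemma factor_weight_attained:
  assumes "i \<le> length w"
  obtains u where "u \<in> factors i w" "factor_weight \<mu> w i = \<mu> u"
proof -
  have "factor_weight \<mu> w i \<in> \<mu> ` factors i w"
    unfolding factor_weight_def using take_in_factors[OF assms]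
    by (intro Max_in finite_imageI finite_factors) auto
  then show ?thesis using that by blast
qed

lemma weight_measure_append:
  assumes "weight_measure \<Sigma> \<mu>" "u \<in> lists \<Sigma>" "v \<in> lists \<Sigma>"
  shows "\<mu> (u @ v) = \<mu> u * \<mu> v"
  using assms unfolding weight_measure_def by blast

lemma weight_measure_Nil: "weight_measure \<Sigma> \<mu> \<Longrightarrow> \<mu> [] = 1"
  unfolding weight_measure_def by blast

lemma weight_measure_take_Suc:
  assumes "weight_measure \<Sigma> \<mu>" "v \<in> lists \<Sigma>" "i < length v"
  shows "\<mu> (take (Suc i) v) = \<mu> (take i v) * \<mu> [v ! i]"
proof -
  have "take i v \<in> lists \<Sigma>" "[v ! i] \<in> lists \<Sigma>"
    using assms(2,3) by (auto dest: in_set_takeD)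
  then show ?thesis
    using weight_measure_append[OF assms(1)] assms(3) by (simp add: take_Suc_conv_app_nth)
qed

lemma factor_weight_0:
  assumes "weight_measure \<Sigma> \<mu>"
  shows "factor_weight \<mu> w 0 = 1"
proof -
  have "factors 0 w = {[]}"
    by (auto simp: factors_def)
  then show ?thesis
    by (simp add: factor_weight_def weight_measure_Nil[OF assms])
qed

text \<open>Cut a heaviest factor of length \<open>i + j\<close> after its first \<open>i\<close>
  letters: both pieces are again factors of \<open>w\<close>.\<close>

lemma factor_weight_add_le:
  assumes "weight_measure \<Sigma> \<mu>" "w \<in> lists \<Sigma>" "i + j \<le> length w"
  shows "factor_weight \<mu> w (i + j) \<le> factor_weight \<mu> w i * factor_weight \<mu> w j"
proof -
  obtain u where u: "u \<in> factors (i + j) w" "factor_weight \<mu> w (i + j) = \<mu> u"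
    using factor_weight_attained[OF assms(3)] .
  have parts: "take i u \<in> factors i w" "drop i u \<in> factors j w"
    using u(1) assms(3) sublist_order.order_trans[OF sublist_take, of u w i]
      sublist_order.order_trans[OF sublist_drop, of u w i]
    by (simp_all add: factors_def)
  have "\<mu> (take i u @ drop i u) = \<mu> (take i u) * \<mu> (drop i u)"
    using parts factors_subset_lists[OF assms(2)]
    by (intro weight_measure_append[OF assms(1)]) auto
  also have "\<dots> \<le> factor_weight \<mu> w i * factor_weight \<mu> w j"
    by (intro mult_le_mono factor_weight_ge parts)
  finally show ?thesis by (simp add: u(2))
qed

lemma factor_weight_eq_if_prefix_weight_eq:
  assumes \<mu>: "weight_measure \<Sigma> \<mu>" and w: "w \<in> lists \<Sigma>" and v: "v \<in> lists \<Sigma>"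
    and len: "length v = length w"
    and eq: "\<forall>i\<le>length w. \<mu> (take i v) = factor_weight \<mu> w i"
    and i: "i \<le> length w"
  shows "factor_weight \<mu> v i = factor_weight \<mu> w i"
proof (rule antisym)
  obtain u where u: "u \<in> factors i v" "factor_weight \<mu> v i = \<mu> u"
    using factor_weight_attained i len by metis
  then obtain ps ss where split: "v = ps @ u @ ss" and "length u = i"
    by (auto simp: factors_def sublist_def)
  let ?j = "length ps"
  have le: "?j + i \<le> length w"
    using len split \<open>length u = i\<close> by simp
  \<comment> \<open>Replacing the weight of \<open>ps\<close> by a factor weight of \<open>w\<close>
    puts the same left factor on both ends of the chain, ready to be cancelled.\<close>
  have "factor_weight \<mu> w ?j * \<mu> u = \<mu> (take ?j v) * \<mu> u"
    using eq le by simp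
  also have "\<dots> = \<mu> (take (?j + i) v)"
    using weight_measure_append[OF \<mu>, of ps u] v split \<open>length u = i\<close> by simp
  also have "\<dots> = factor_weight \<mu> w (?j + i)"
    using eq le by blast
  also have "\<dots> \<le> factor_weight \<mu> w ?j * factor_weight \<mu> w i"
    using factor_weight_add_le[OF \<mu> w le] .
  finally show "factor_weight \<mu> v i \<le> factor_weight \<mu> w i"
    by (simp add: mult_left_le_cancel_iff u(2))
next
  \<comment> \<open>The prefix of \<open>v\<close> of length \<open>i\<close> is a factor of
    \<open>v\<close> and already has the weight \<open>factor_weight \<mu> w i\<close>.\<close>
  show "factor_weight \<mu> w i \<le> factor_weight \<mu> v i"
    using eq i len factor_weight_ge[OF take_in_factors, of i v \<mu>] by simp
qed

text \<open>This removes the factor weights of \<open>v\<close> from the membership condition, so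
  that only its prefix weights remain to be checked.\<close>

lemma prefix_normal_words_iff:
  assumes "weight_measure \<Sigma> \<mu>" "w \<in> lists \<Sigma>"
  shows "v \<in> prefix_normal_words \<Sigma> \<mu> w \<longleftrightarrow>
    v \<in> lists \<Sigma> \<and> length v = length w \<and> (\<forall>i\<le>length w. \<mu> (take i v) = factor_weight \<mu> w i)"
  using factor_weight_eq_if_prefix_weight_eq[OF assms, of v]
  by (auto simp: prefix_normal_words_def factor_weight_class_def factor_weight_equiv_def
      prefix_weight_def in_lists_conv_set)

text \<open>As \<open>card\<close> is 0 on infinite sets, finiteness is what lets
  \<open>card = 0\<close> mean emptiness.\<close>

lemma finite_prefix_normal_words:
  assumes "finite \<Sigma>"
  shows "finite (prefix_normal_words \<Sigma> \<mu> w)"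
proof (rule finite_subset)
  show "prefix_normal_words \<Sigma> \<mu> w \<subseteq> {v. set v \<subseteq> \<Sigma> \<and> length v = length w}"
    by (auto simp: prefix_normal_words_def factor_weight_class_def factor_weight_equiv_def)
qed (use assms in \<open>rule finite_lists_length_eq\<close>)

lemma prefix_normal_words_nonempty:
  assumes \<mu>: "weight_measure \<Sigma> \<mu>" and w: "w \<in> lists \<Sigma>" and gf: "gapfree \<Sigma> \<mu>"
  shows "prefix_normal_words \<Sigma> \<mu> w \<noteq> {}"
proof -
  have "\<exists>a\<in>\<Sigma>. factor_weight \<mu> w (Suc i) = factor_weight \<mu> w i * \<mu> [a]" if "i < length w" for i
    using gf[unfolded gapfree_def, rule_format, OF w, of "Suc i"] that by simp
  \<comment> \<open>The letter \<open>g i\<close> depends on \<open>w\<close> and \<open>i\<close>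
    only, not on the letters chosen before it, so the whole word can be written down at
    once.\<close>
  then obtain g where g: "g i \<in> \<Sigma>" "factor_weight \<mu> w (Suc i) = factor_weight \<mu> w i * \<mu> [g i]"
    if "i < length w" for i
    by metis
  define v where "v = map g [0..<length w]"
  have v: "v \<in> lists \<Sigma>" "length v = length w"
    using g(1) by (auto simp: v_def)
  have "\<mu> (take i v) = factor_weight \<mu> w i" if "i \<le> length w" for i
    using that
  proof (induction i)
    case 0
    show ?case
      using weight_measure_Nil[OF \<mu>] factor_weight_0[OF \<mu>] by simp
  next
    case (Suc i)
    then show ?case
      using weight_measure_take_Suc[OF \<mu> v(1), of i] g(2)[of i] v(2) by (simp add: v_def)
  qed
  then have "v \<in> prefix_normal_words \<Sigma> \<mu> w"
    using v prefix_normal_words_iff[OF \<mu> w] by blast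
  then show ?thesis by blast
qed

lemma gapfree_if_prefix_normal_words_nonempty:
  assumes \<mu>: "weight_measure \<Sigma> \<mu>"
    and nonempty: "\<And>w. w \<in> lists \<Sigma> \<Longrightarrow> prefix_normal_words \<Sigma> \<mu> w \<noteq> {}"
  shows "gapfree \<Sigma> \<mu>"
  unfolding gapfree_def
proof (intro ballI)
  fix w i
  assume w: "w \<in> lists \<Sigma>" and i: "i \<in> {1..length w}"
  obtain v where v: "v \<in> lists \<Sigma>" "length v = length w"
    "\<forall>i\<le>length w. \<mu> (take i v) = factor_weight \<mu> w i"
    using nonempty[OF w] prefix_normal_words_iff[OF \<mu> w] by blast
  \<comment> \<open>The letter that extends the prefix of length \<open>i - 1\<close> sits at index
    \<open>i - 1\<close>, as lists are indexed from 0; it witnesses gapfreeness for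
    \<open>w\<close>.\<close>
  have "factor_weight \<mu> w i = factor_weight \<mu> w (i - 1) * \<mu> [v ! (i - 1)]"
    using weight_measure_take_Suc[OF \<mu> v(1), of "i - 1"] v(2,3) i by (cases i) auto
  moreover have "v ! (i - 1) \<in> \<Sigma>"
    using v(1,2) i by (auto simp: in_lists_conv_set)
  ultimately show "\<exists>a\<in>\<Sigma>. factor_weight \<mu> w i = factor_weight \<mu> w (i - 1) * \<mu> [a]"
    by blast
qed

lemma prefix_normal_words_unique:
  assumes \<mu>: "weight_measure \<Sigma> \<mu>" and w: "w \<in> lists \<Sigma>" and inj: "injective_measure \<Sigma> \<mu>"
    and "u \<in> prefix_normal_words \<Sigma> \<mu> w" "v \<in> prefix_normal_words \<Sigma> \<mu> w"
  shows "u = v"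
proof (rule nth_equalityI)
  have u: "u \<in> lists \<Sigma>" "length u = length w"
    and v: "v \<in> lists \<Sigma>" "length v = length w"
    and eq: "\<And>i. i \<le> length w \<Longrightarrow> \<mu> (take i u) = \<mu> (take i v)"
    using assms(4,5) prefix_normal_words_iff[OF \<mu> w] by auto
  show "length u = length v"
    using u v by simp
  fix i
  assume "i < length u"
  then have i: "i < length u" "i < length v" "i < length w"
    using u v by auto
  have "\<mu> (take i u) * \<mu> [u ! i] = \<mu> (take i u) * \<mu> [v ! i]"
    using eq[of i] eq[of "Suc i"] i weight_measure_take_Suc[OF \<mu> u(1)]
      weight_measure_take_Suc[OF \<mu> v(1)] by simp
  then have "\<mu> [u ! i] = \<mu> [v ! i]"
    by (simp add: mult_left_eq_cancel_iff)
  moreover have "u ! i \<in> \<Sigma>" "v ! i \<in> \<Sigma>"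
    using u(1) v(1) i by (auto simp: in_lists_conv_set)
  ultimately show "u ! i = v ! i"
    using inj by (auto simp: injective_measure_def dest: inj_onD)
qed

text \<open>Two letters of equal weight refute uniqueness already at length 1. The case
  \<open>b = a\<close> covers \<open>[a]\<close> itself.\<close>

lemma singleton_in_prefix_normal_words:
  assumes \<mu>: "weight_measure \<Sigma> \<mu>" and "a \<in> \<Sigma>" "b \<in> \<Sigma>" "\<mu> [a] = \<mu> [b]"
  shows "[b] \<in> prefix_normal_words \<Sigma> \<mu> [a]"
proof -
  have "factors 1 [a] = {[a]}"
    by (auto simp: factors_def sublist_Cons_right prefix_Cons)
  then have "factor_weight \<mu> [a] 1 = \<mu> [b]"
    using assms(4) by (simp add: factor_weight_def)
  then show ?thesis
    using assms weight_measure_Nil[OF \<mu>] factor_weight_0[OF \<mu>]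
    by (auto simp: prefix_normal_words_iff[OF \<mu>] le_Suc_eq)
qed

theorem theorem13:
  fixes \<Sigma> :: "'a set" and \<mu> :: "'a list \<Rightarrow> 'm::strict_total_ordered_monoid"
  assumes "finite \<Sigma>" and "weight_measure \<Sigma> \<mu>"
  shows "((\<exists>w\<in>lists \<Sigma>. card (prefix_normal_words \<Sigma> \<mu> w) = 0) \<longleftrightarrow> gapful \<Sigma> \<mu>) \<and>
         ((\<exists>w\<in>lists \<Sigma>. card (prefix_normal_words \<Sigma> \<mu> w) > 1) \<longleftrightarrow> \<not> injective_measure \<Sigma> \<mu>) \<and>
         ((\<forall>w\<in>lists \<Sigma>. card (prefix_normal_words \<Sigma> \<mu> w) = 1) \<longleftrightarrow>
            gapfree \<Sigma> \<mu> \<and> injective_measure \<Sigma> \<mu>)"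
proof -
  let ?P = "prefix_normal_words \<Sigma> \<mu>"
  note fin = finite_prefix_normal_words[OF assms(1), of \<mu>]
  have zero: "(\<exists>w\<in>lists \<Sigma>. card (?P w) = 0) \<longleftrightarrow> gapful \<Sigma> \<mu>"
    using prefix_normal_words_nonempty[OF assms(2)]
      gapfree_if_prefix_normal_words_nonempty[OF assms(2)]
    unfolding card_0_eq[OF fin] by blast
  have many: "(\<exists>w\<in>lists \<Sigma>. card (?P w) > 1) \<longleftrightarrow> \<not> injective_measure \<Sigma> \<mu>"
  proof
    assume "\<exists>w\<in>lists \<Sigma>. card (?P w) > 1"
    \<comment> \<open>By contraposition: for a finite set, having at most one element means that any
      two elements are equal.\<close>
    then show "\<not> injective_measure \<Sigma> \<mu>"
      using prefix_normal_words_unique[OF assms(2)] card_le_Suc0_iff_eq[OF fin]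
      by (metis One_nat_def linorder_not_less)
  next
    assume "\<not> injective_measure \<Sigma> \<mu>"
    then obtain a b where ab: "a \<in> \<Sigma>" "b \<in> \<Sigma>" "\<mu> [a] = \<mu> [b]" "a \<noteq> b"
      by (auto simp: injective_measure_def inj_on_def)
    then have "[a] \<in> ?P [a]" "[b] \<in> ?P [a]"
      using singleton_in_prefix_normal_words[OF assms(2)] by auto
    then have "card (?P [a]) > 1"
      using fin ab(4) by (metis One_nat_def card_le_Suc0_iff_eq linorder_not_less list.inject)
    then show "\<exists>w\<in>lists \<Sigma>. card (?P w) > 1"
      using ab(1) by (intro bexI[of _ "[a]"]) auto
  qed
  \<comment> \<open>The third claim follows from the first two by arithmetic on the cardinality
    alone.\<close>
  have "n = 1 \<longleftrightarrow> n \<noteq> 0 \<and> \<not> n > 1" for n :: nat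
    by arith
  with zero many show ?thesis by blast
qed

end
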